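(* For every diameter bound $\ell>0$ there exists a $(\Gamma,d+1)$-hash $\varphi:\mathbb{R}^d\to\mathbb{R}^d$ with diameter bound $\ell$, for $\Gamma=\Theta(d\sqrt d)$. Furthermore, $\varphi$ is determined solely by $d$ and the diameter bound $\ell$, and one can evaluate $\varphi(x)$ for an input $x\in\mathbb{R}^d$ in time and space $\mathrm{poly}(d)$.
   Context: A mapping $\varphi:\mathbb{R}^d\to\mathbb{R}^d$ is a $(\Gamma,\Lambda)$-hash with diameter bound $\ell>0$ if (1) for every $z\in\varphi(\mathbb{R}^d)$, the Euclidean diameter of $\varphi^{-1}(z)$ is at most $\ell$, and (2) every $S\subseteq\mathbb{R}^d$ of Euclidean diameter at most $\ell/\Gamma$ satisfies $|\varphi(S)|\le\Lambda$. *)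

theory Defs
  imports
    "HOL-Analysis.Analysis"
    "HOL-Library.Landau_Symbols"
    "HOL-Computational_Algebra.Polynomial"
begin

text \<open>
  The dimension varies inside the statements, so \<open>\<real>\<^sup>d\<close> is
  \<^term>\<open>topspace (Euclidean_space d)\<close>, the functions \<^typ>\<open>nat \<Rightarrow> real\<close> that vanish
  from index \<^term>\<open>d\<close> on.
\<close>

definition eucl_dist :: "nat \<Rightarrow> (nat \<Rightarrow> real) \<Rightarrow> (nat \<Rightarrow> real) \<Rightarrow> real" where
  "eucl_dist d x y = L2_set (\<lambda>i. x i - y i) {..<d}"

text \<open>The diameter is an extended real, so that an unbounded set has diameter \<open>\<infinity>\<close>.\<close>

definition eucl_diam :: "nat \<Rightarrow> (nat \<Rightarrow> real) set \<Rightarrow> ennreal" where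
  "eucl_diam d S = (SUP x\<in>S. SUP y\<in>S. ennreal (eucl_dist d x y))"

definition is_hash ::
  "nat \<Rightarrow> real \<Rightarrow> nat \<Rightarrow> real \<Rightarrow> ((nat \<Rightarrow> real) \<Rightarrow> (nat \<Rightarrow> real)) \<Rightarrow> bool" where
  "is_hash d \<Gamma> \<Lambda> l \<phi> \<longleftrightarrow>
     0 < \<Gamma> \<and> 0 < l \<and>
     \<phi> \<in> topspace (Euclidean_space d) \<rightarrow> topspace (Euclidean_space d) \<and>
     (\<forall>z \<in> \<phi> ` topspace (Euclidean_space d).
        eucl_diam d {x \<in> topspace (Euclidean_space d). \<phi> x = z} \<le> ennreal l) \<and>
     (\<forall>S \<subseteq> topspace (Euclidean_space d).
        eucl_diam d S \<le> ennreal (l / \<Gamma>) \<longrightarrow> finite (\<phi> ` S) \<and> card (\<phi> ` S) \<le> \<Lambda>)"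

text \<open>
  Running time and space refer to a real RAM with unit-cost arithmetic, comparisons and
  floor. It has registers, addressed directly by the program text, and a memory, addressed
  indirectly through the contents of a register. A program is one fixed finite list of
  instructions with integer constants; the dimension and the diameter bound are inputs of it.
\<close>

datatype instr =
    Const nat int
  | Add nat nat nat
  | Sub nat nat nat
  | Mul nat nat nat
  | Div nat nat nat
  | Floor nat nat
  | Load nat nat
  | Store nat nat
  | JumpLe nat nat nat

type_synonym regs = "nat \<Rightarrow> real"
type_synonym memory = "nat \<Rightarrow> real"
type_synonym config = "nat \<times> regs \<times> memory"

definition addr :: "real \<Rightarrow> nat" where
  "addr a = nat \<lfloor>a\<rfloor>"

text \<open>
  In each instruction the first argument is the target; in \<^term>\<open>Store i j\<close> register
  \<^term>\<open>i\<close> holds the target address. Division by \<open>0\<close> gives \<open>0\<close>, as always in HOL.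
\<close>

fun exec_instr :: "instr \<Rightarrow> config \<Rightarrow> config" where
  "exec_instr (Const i c) (pc, r, m) = (Suc pc, r(i := of_int c), m)"
| "exec_instr (Add i j k) (pc, r, m) = (Suc pc, r(i := r j + r k), m)"
| "exec_instr (Sub i j k) (pc, r, m) = (Suc pc, r(i := r j - r k), m)"
| "exec_instr (Mul i j k) (pc, r, m) = (Suc pc, r(i := r j * r k), m)"
| "exec_instr (Div i j k) (pc, r, m) = (Suc pc, r(i := r j / r k), m)"
| "exec_instr (Floor i j) (pc, r, m) = (Suc pc, r(i := of_int \<lfloor>r j\<rfloor>), m)"
| "exec_instr (Load i j) (pc, r, m) = (Suc pc, r(i := m (addr (r j))), m)"
| "exec_instr (Store i j) (pc, r, m) = (Suc pc, r, m(addr (r i) := r j))"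
| "exec_instr (JumpLe l i j) (pc, r, m) = (if r i \<le> r j then l else Suc pc, r, m)"

fun regs_used :: "instr \<Rightarrow> nat set" where
  "regs_used (Const i c) = {i}"
| "regs_used (Add i j k) = {i, j, k}"
| "regs_used (Sub i j k) = {i, j, k}"
| "regs_used (Mul i j k) = {i, j, k}"
| "regs_used (Div i j k) = {i, j, k}"
| "regs_used (Floor i j) = {i, j}"
| "regs_used (Load i j) = {i, j}"
| "regs_used (Store i j) = {i, j}"
| "regs_used (JumpLe l i j) = {i, j}"

fun mem_used :: "instr \<Rightarrow> regs \<Rightarrow> nat set" where
  "mem_used (Load i j) r = {addr (r j)}"
| "mem_used (Store i j) r = {addr (r i)}"
| "mem_used _ r = {}"

definition halted :: "instr list \<Rightarrow> config \<Rightarrow> bool" where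
  "halted P c \<longleftrightarrow> fst c \<ge> length P"

definition step :: "instr list \<Rightarrow> config \<Rightarrow> config" where
  "step P c = (if halted P c then c else exec_instr (P ! fst c) c)"

definition within_space :: "instr list \<Rightarrow> nat \<Rightarrow> config \<Rightarrow> bool" where
  "within_space P s c \<longleftrightarrow>
     (\<not> halted P c \<longrightarrow>
        regs_used (P ! fst c) \<union> mem_used (P ! fst c) (fst (snd c)) \<subseteq> {..<s})"

definition init_config :: "nat \<Rightarrow> real \<Rightarrow> (nat \<Rightarrow> real) \<Rightarrow> config" where
  "init_config d l x = (0, (\<lambda>_. 0)(0 := real d, 1 := l), x)"

text \<open>
  On every input \<open>(d, l, x)\<close> with \<open>x \<in> \<real>\<^sup>d\<close>, program \<open>P\<close> halts after at most \<open>t\<close> steps with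
  \<open>\<phi> x\<close> in the first \<open>d\<close> memory cells, touching only the first \<open>s\<close> registers and the first
  \<open>s\<close> memory cells.
\<close>

definition evaluates_within ::
  "instr list \<Rightarrow> nat \<Rightarrow> real \<Rightarrow> ((nat \<Rightarrow> real) \<Rightarrow> (nat \<Rightarrow> real)) \<Rightarrow> nat \<Rightarrow> nat \<Rightarrow> bool" where
  "evaluates_within P d l \<phi> t s \<longleftrightarrow>
     (\<forall>x \<in> topspace (Euclidean_space d). \<exists>n \<le> t.
        halted P ((step P ^^ n) (init_config d l x)) \<and>
        (\<forall>i<d. snd (snd ((step P ^^ n) (init_config d l x))) i = \<phi> x i) \<and>
        (\<forall>k<n. within_space P s ((step P ^^ k) (init_config d l x))))"

end

theory Submission
  imports Defs "HOL-Real_Asymp.Real_Asymp"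
begin

text \<open>
  Rescale so that the lattice cubes have side 1 and diameter at most the bound \<open>l\<close>, and put
  \<open>\<epsilon> = 1 / (2d + 3)\<close>. Let the level of a point be the least \<open>m\<close> such that at most \<open>m\<close>
  coordinates are within \<open>(m + 1)\<epsilon>\<close> of an integer. By minimality at least \<open>m\<close> coordinates are
  within \<open>m\<epsilon>\<close> of an integer, so no coordinate has a distance in \<open>(m\<epsilon>, (m + 1)\<epsilon>]\<close>. Round the
  coordinates within \<open>m\<epsilon>\<close> of an integer to that integer, and the others to the open unit
  interval containing them. Because of the gap, two points of the same level at distance at most
  \<open>\<epsilon>\<close> are rounded alike, so a set of diameter \<open>\<epsilon>\<close> gets at most one value for each of the
  \<open>d + 1\<close> levels. The machine has no square root, so the scale uses the least integer
  \<open>s\<close> with \<open>d \<le> s\<^sup>2\<close> in place of \<open>\<surd>d\<close>.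
\<close>

section \<open>The hash\<close>

definition int_dist :: "real \<Rightarrow> real" where
  "int_dist u = \<bar>u - of_int (round u)\<bar>"

lemma int_dist_le: "int_dist u \<le> \<bar>u - of_int n\<bar>"
  unfolding int_dist_def by (rule round_diff_minimal)

lemma int_dist_lipschitz: "int_dist v \<le> int_dist u + \<bar>u - v\<bar>"
  using int_dist_le[of v "round u"] unfolding int_dist_def by linarith

text \<open>Even values stand for integers and odd values for open unit intervals.\<close>

definition cell :: "real \<Rightarrow> real \<Rightarrow> int" where
  "cell t u = (if int_dist u \<le> t then 2 * round u else 2 * \<lfloor>u\<rfloor> + 1)"

lemma cell_eq_imp_close:
  assumes "cell t u = cell t' v"
  shows "\<bar>u - v\<bar> < 1"
proof -
  have "round u = round v \<or> \<lfloor>u\<rfloor> = \<lfloor>v\<rfloor>"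
    using assms unfolding cell_def by (auto split: if_splits) presburger+
  then show ?thesis
  proof
    assume "\<lfloor>u\<rfloor> = \<lfloor>v\<rfloor>"
    then show ?thesis by linarith
  qed (rule round_eq_imp_diff_1)
qed

lemma floor_eq_if_far_from_int:
  assumes "\<bar>u - v\<bar> < int_dist u" "\<bar>u - v\<bar> < int_dist v"
  shows "\<lfloor>u\<rfloor> = \<lfloor>v\<rfloor>"
  using assms int_dist_le[of u "\<lfloor>v\<rfloor>"] int_dist_le[of v "\<lfloor>u\<rfloor>"] by linarith

lemma cell_eq_if_close:
  assumes t: "0 \<le> t" "2 * t + e < 1" and close: "\<bar>u - v\<bar> \<le> e"
    and gap: "int_dist u \<le> t \<or> t + e < int_dist u" "int_dist v \<le> t \<or> t + e < int_dist v"
  shows "cell t u = cell t v"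
proof (cases "int_dist u \<le> t")
  case True
  then have near: "int_dist u \<le> t" "int_dist v \<le> t"
    using gap close int_dist_lipschitz[of v u] by linarith+
  then have "\<bar>real_of_int (round u - round v)\<bar> < 1"
    using t close unfolding int_dist_def of_int_diff by linarith
  then have "round u = round v" by linarith
  with near show ?thesis by (simp add: cell_def)
next
  case False
  then have far: "t + e < int_dist u" "t + e < int_dist v"
    using gap close int_dist_lipschitz[of u v] by linarith+
  then have "\<lfloor>u\<rfloor> = \<lfloor>v\<rfloor>"
    using t close by (intro floor_eq_if_far_from_int) linarith+
  moreover have "\<not> int_dist u \<le> t" "\<not> int_dist v \<le> t"
    using far close by linarith+
  ultimately show ?thesis by (simp add: cell_def)
qed

definition near_coords :: "nat \<Rightarrow> real \<Rightarrow> (nat \<Rightarrow> real) \<Rightarrow> nat set" where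
  "near_coords d t x = {j. j < d \<and> int_dist (x j) \<le> t}"

lemma near_coords_subset: "near_coords d t x \<subseteq> {..<d}"
  by (auto simp: near_coords_def)

lemma finite_near_coords: "finite (near_coords d t x)"
  using near_coords_subset by (rule finite_subset) simp

lemma card_near_coords_le: "card (near_coords d t x) \<le> d"
  using card_mono[OF _ near_coords_subset[of d t x]] by simp

lemma near_coords_mono: "t \<le> t' \<Longrightarrow> near_coords d t x \<subseteq> near_coords d t' x"
  by (auto simp: near_coords_def)

lemma near_coords_0: "near_coords 0 t x = {}"
  by (simp add: near_coords_def)

lemma card_near_coords_Suc:
  "card (near_coords (Suc k) t x) = card (near_coords k t x) + of_bool (int_dist (x k) \<le> t)"
proof -
  have "near_coords (Suc k) t x = (if int_dist (x k) \<le> t then {k} else {}) \<union> near_coords k t x"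
    by (auto simp: near_coords_def less_Suc_eq)
  then show ?thesis
    by (simp add: card_insert_if finite_near_coords) (simp add: near_coords_def)
qed

definition level :: "nat \<Rightarrow> real \<Rightarrow> (nat \<Rightarrow> real) \<Rightarrow> nat" where
  "level d \<epsilon> x = (LEAST m. card (near_coords d (real (Suc m) * \<epsilon>) x) \<le> m)"

lemma card_near_coords_level_le:
  "card (near_coords d (real (Suc (level d \<epsilon> x)) * \<epsilon>) x) \<le> level d \<epsilon> x"
  unfolding level_def by (rule LeastI[of _ d]) (rule card_near_coords_le)

lemma level_le: "level d \<epsilon> x \<le> d"
  unfolding level_def by (rule Least_le) (rule card_near_coords_le)

lemma less_card_near_coords_if_less_level:
  "m < level d \<epsilon> x \<Longrightarrow> m < card (near_coords d (real (Suc m) * \<epsilon>) x)"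
  unfolding level_def using not_less_Least by (meson not_le)

lemma near_coords_level_eq_Suc:
  assumes "0 \<le> \<epsilon>"
  shows "near_coords d (real (level d \<epsilon> x) * \<epsilon>) x = near_coords d (real (Suc (level d \<epsilon> x)) * \<epsilon>) x"
proof (rule card_seteq[OF finite_near_coords])
  show "near_coords d (real (level d \<epsilon> x) * \<epsilon>) x \<subseteq> near_coords d (real (Suc (level d \<epsilon> x)) * \<epsilon>) x"
    using assms by (intro near_coords_mono mult_right_mono) auto
  have "level d \<epsilon> x \<le> card (near_coords d (real (level d \<epsilon> x) * \<epsilon>) x)"
    using less_card_near_coords_if_less_level[of "level d \<epsilon> x - 1" d \<epsilon> x]
    by (cases "level d \<epsilon> x") auto
  with card_near_coords_level_le
  show "card (near_coords d (real (Suc (level d \<epsilon> x)) * \<epsilon>) x)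
      \<le> card (near_coords d (real (level d \<epsilon> x) * \<epsilon>) x)"
    by (rule order_trans)
qed

lemma level_gap:
  assumes "0 \<le> \<epsilon>" "j < d"
  shows "int_dist (x j) \<le> real (level d \<epsilon> x) * \<epsilon> \<or> real (level d \<epsilon> x) * \<epsilon> + \<epsilon> < int_dist (x j)"
proof -
  have "j \<in> near_coords d (real (level d \<epsilon> x) * \<epsilon>) x
      \<longleftrightarrow> j \<in> near_coords d (real (Suc (level d \<epsilon> x)) * \<epsilon>) x"
    by (simp only: near_coords_level_eq_Suc[OF \<open>0 \<le> \<epsilon>\<close>])
  with \<open>j < d\<close> show ?thesis by (auto simp: near_coords_def algebra_simps)
qed

definition lattice_hash :: "nat \<Rightarrow> real \<Rightarrow> (nat \<Rightarrow> real) \<Rightarrow> nat \<Rightarrow> real" where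
  "lattice_hash d \<epsilon> x = (\<lambda>j. if j < d then of_int (cell (real (level d \<epsilon> x) * \<epsilon>) (x j)) else 0)"

lemma lattice_hash_eq_imp_close:
  assumes "lattice_hash d \<epsilon> x = lattice_hash d \<epsilon> y" "j < d"
  shows "\<bar>x j - y j\<bar> < 1"
  using fun_cong[OF assms(1), of j] assms(2)
  by (intro cell_eq_imp_close) (simp add: lattice_hash_def)

lemma lattice_hash_eq_if_close:
  assumes \<epsilon>: "0 \<le> \<epsilon>" "(2 * real d + 1) * \<epsilon> < 1"
    and level_eq: "level d \<epsilon> x = level d \<epsilon> y"
    and close: "\<And>j. j < d \<Longrightarrow> \<bar>x j - y j\<bar> \<le> \<epsilon>"
  shows "lattice_hash d \<epsilon> x = lattice_hash d \<epsilon> y"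
proof -
  let ?t = "real (level d \<epsilon> x) * \<epsilon>"
  have "?t \<le> real d * \<epsilon>" using \<epsilon>(1) level_le by (intro mult_right_mono) auto
  with \<epsilon>(2) have "2 * ?t + \<epsilon> < 1" by (simp add: algebra_simps)
  then have "cell ?t (x j) = cell ?t (y j)" if "j < d" for j
    using \<epsilon>(1) close level_gap[OF \<epsilon>(1), of j d x] level_gap[OF \<epsilon>(1), of j d y] that level_eq
    by (intro cell_eq_if_close[where e = \<epsilon>]) auto
  then show ?thesis unfolding lattice_hash_def level_eq by auto
qed

lemma eucl_dist_eq_L2_set_abs: "eucl_dist d x y = L2_set (\<lambda>j. \<bar>x j - y j\<bar>) {..<d}"
  by (simp add: eucl_dist_def L2_set_def)

lemma eucl_dist_le_if_coords_le:
  assumes "\<And>j. j < d \<Longrightarrow> \<bar>x j - y j\<bar> \<le> b" "0 \<le> b"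
  shows "eucl_dist d x y \<le> sqrt (real d) * b"
proof -
  have "L2_set (\<lambda>j. \<bar>x j - y j\<bar>) {..<d} \<le> L2_set (\<lambda>_. b) {..<d}"
    using assms by (intro L2_set_mono) auto
  with \<open>0 \<le> b\<close> show ?thesis by (simp add: eucl_dist_eq_L2_set_abs L2_set_constant)
qed

lemma coord_diff_le_eucl_dist: "j < d \<Longrightarrow> \<bar>x j - y j\<bar> \<le> eucl_dist d x y"
  unfolding eucl_dist_eq_L2_set_abs by (rule member_le_L2_set) auto

lemma eucl_dist_scale:
  assumes "0 \<le> c"
  shows "eucl_dist d (\<lambda>i. x i * c) (\<lambda>i. y i * c) = eucl_dist d x y * c"
  by (simp add: eucl_dist_def L2_set_left_distrib[OF assms] left_diff_distrib)

lemma eucl_diam_le_iff: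
  assumes "0 \<le> b"
  shows "eucl_diam d S \<le> ennreal b \<longleftrightarrow> (\<forall>x\<in>S. \<forall>y\<in>S. eucl_dist d x y \<le> b)"
  using assms by (simp add: eucl_diam_def SUP_le_iff)

lemma is_hash_iff:
  "is_hash d \<Gamma> \<Lambda> l \<phi> \<longleftrightarrow>
     0 < \<Gamma> \<and> 0 < l \<and>
     \<phi> \<in> topspace (Euclidean_space d) \<rightarrow> topspace (Euclidean_space d) \<and>
     (\<forall>x \<in> topspace (Euclidean_space d). \<forall>y \<in> topspace (Euclidean_space d).
        \<phi> x = \<phi> y \<longrightarrow> eucl_dist d x y \<le> l) \<and>
     (\<forall>S \<subseteq> topspace (Euclidean_space d). (\<forall>x\<in>S. \<forall>y\<in>S. eucl_dist d x y \<le> l / \<Gamma>) \<longrightarrow>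
        finite (\<phi> ` S) \<and> card (\<phi> ` S) \<le> \<Lambda>)"
proof (cases "0 < \<Gamma> \<and> 0 < l")
  case True
  then show ?thesis by (auto simp: is_hash_def eucl_diam_le_iff)
qed (auto simp: is_hash_def)

lemma is_hash_scale:
  assumes "is_hash d \<Gamma> \<Lambda> l \<phi>" "0 < c"
  shows "is_hash d \<Gamma> \<Lambda> (l / c) (\<lambda>x. \<phi> (\<lambda>i. x i * c))"
proof -
  let ?E = "topspace (Euclidean_space d)" and ?scale = "\<lambda>x i. x i * c"
  have scale: "?scale x \<in> ?E" if "x \<in> ?E" for x
    using that by (auto simp: topspace_Euclidean_space)
  have dist: "eucl_dist d (?scale x) (?scale y) \<le> b \<longleftrightarrow> eucl_dist d x y \<le> b / c" for x y b
    using \<open>0 < c\<close> by (simp add: eucl_dist_scale pos_le_divide_eq)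
  have pos: "0 < \<Gamma>" "0 < l" and maps: "\<phi> \<in> ?E \<rightarrow> ?E"
    and hash_fibre: "\<And>x y. x \<in> ?E \<Longrightarrow> y \<in> ?E \<Longrightarrow> \<phi> x = \<phi> y \<Longrightarrow> eucl_dist d x y \<le> l"
    and hash_few: "\<And>S. S \<subseteq> ?E \<Longrightarrow> \<forall>x\<in>S. \<forall>y\<in>S. eucl_dist d x y \<le> l / \<Gamma> \<Longrightarrow>
      finite (\<phi> ` S) \<and> card (\<phi> ` S) \<le> \<Lambda>"
    using assms(1) unfolding is_hash_iff by blast+
  have few: "finite ((\<lambda>x. \<phi> (?scale x)) ` S) \<and> card ((\<lambda>x. \<phi> (?scale x)) ` S) \<le> \<Lambda>"
    if "S \<subseteq> ?E" "\<forall>x\<in>S. \<forall>y\<in>S. eucl_dist d x y \<le> l / c / \<Gamma>" for S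
  proof -
    have "?scale ` S \<subseteq> ?E" using scale that(1) by blast
    moreover have "\<forall>x \<in> ?scale ` S. \<forall>y \<in> ?scale ` S. eucl_dist d x y \<le> l / \<Gamma>"
      using that(2) by (simp add: dist mult.commute[of \<Gamma> c])
    ultimately have "finite (\<phi> ` ?scale ` S) \<and> card (\<phi> ` ?scale ` S) \<le> \<Lambda>"
      by (rule hash_few)
    then show ?thesis by (simp add: image_image)
  qed
  have fibre: "eucl_dist d x y \<le> l / c"
    if "x \<in> ?E" "y \<in> ?E" "\<phi> (?scale x) = \<phi> (?scale y)" for x y
    using hash_fibre[OF scale scale, OF that] by (simp add: dist)
  show ?thesis
    unfolding is_hash_iff using pos \<open>0 < c\<close> maps scale fibre few by (simp add: Pi_iff)
qed

lemma is_hash_lattice_hash: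
  assumes \<epsilon>: "0 < \<epsilon>" "(2 * real d + 1) * \<epsilon> < 1" and s: "0 < s" "sqrt (real d) \<le> s"
  shows "is_hash d (s / \<epsilon>) (d + 1) s (lattice_hash d \<epsilon>)"
proof -
  let ?E = "topspace (Euclidean_space d)" and ?h = "lattice_hash d \<epsilon>"
  have fibre: "eucl_dist d x y \<le> s" if "?h x = ?h y" for x y
  proof -
    have "eucl_dist d x y \<le> sqrt (real d) * 1"
      using lattice_hash_eq_imp_close[OF that]
      by (intro eucl_dist_le_if_coords_le) (auto intro: less_imp_le)
    with s(2) show ?thesis by simp
  qed
  have few: "finite (?h ` S) \<and> card (?h ` S) \<le> d + 1"
    if diam: "\<forall>x\<in>S. \<forall>y\<in>S. eucl_dist d x y \<le> s / (s / \<epsilon>)" for S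
  proof -
    have dist: "eucl_dist d x y \<le> \<epsilon>" if "x \<in> S" "y \<in> S" for x y
      using diam that s(1) by simp
    have "?h x = ?h y" if "x \<in> S" "y \<in> S" "level d \<epsilon> x = level d \<epsilon> y" for x y
    proof (rule lattice_hash_eq_if_close[OF less_imp_le[OF \<epsilon>(1)] \<epsilon>(2) that(3)])
      show "\<bar>x j - y j\<bar> \<le> \<epsilon>" if "j < d" for j
        using coord_diff_le_eucl_dist[OF that] dist[OF \<open>x \<in> S\<close> \<open>y \<in> S\<close>] by (rule order_trans)
    qed
    then obtain h where "\<And>x. x \<in> S \<Longrightarrow> ?h x = h (level d \<epsilon> x)"
      using function_factors_left_gen[of "\<lambda>x. x \<in> S" "level d \<epsilon>" ?h] by blast
    then have image: "?h ` S \<subseteq> h ` {..d}" using level_le by auto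
    have "card (?h ` S) \<le> card (h ` {..d})" using image by (intro card_mono) auto
    also have "\<dots> \<le> d + 1" using card_image_le[of "{..d}" h] by simp
    finally show ?thesis using finite_subset[OF image] by simp
  qed
  have "?h \<in> ?E \<rightarrow> ?E" by (auto simp: topspace_Euclidean_space lattice_hash_def)
  with \<epsilon>(1) s(1) fibre few show ?thesis unfolding is_hash_iff by simp
qed

definition ceil_sqrt :: "nat \<Rightarrow> nat" where
  "ceil_sqrt n = nat \<lceil>sqrt (real n)\<rceil>"

lemma sqrt_le_ceil_sqrt: "sqrt (real n) \<le> real (ceil_sqrt n)"
  unfolding ceil_sqrt_def by (rule real_nat_ceiling_ge)

lemma ceil_sqrt_le_iff: "ceil_sqrt n \<le> k \<longleftrightarrow> n \<le> k\<^sup>2"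
proof -
  have "ceil_sqrt n \<le> k \<longleftrightarrow> sqrt (real n) \<le> real k"
    by (simp add: ceil_sqrt_def nat_le_iff ceiling_le_iff)
  also have "\<dots> \<longleftrightarrow> n \<le> k\<^sup>2"
    by (simp add: real_sqrt_le_iff' flip: of_nat_power)
  finally show ?thesis .
qed

lemma ceil_sqrt_pos: "0 < n \<Longrightarrow> 0 < ceil_sqrt n"
  using ceil_sqrt_le_iff[of n 0] by simp

lemma bigtheta_ceil_sqrt:
  "(\<lambda>d. real (ceil_sqrt d) * (2 * real d + 3)) \<in> \<Theta>(\<lambda>d. real d * sqrt (real d))"
  unfolding ceil_sqrt_def by real_asymp


definition level_width :: "nat \<Rightarrow> real" where
  "level_width d = 1 / (2 * real d + 3)"

definition lattice_scale :: "nat \<Rightarrow> real \<Rightarrow> real" where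
  "lattice_scale d l = real (ceil_sqrt d) / l"

definition scaled_lattice_hash :: "nat \<Rightarrow> real \<Rightarrow> (nat \<Rightarrow> real) \<Rightarrow> nat \<Rightarrow> real" where
  "scaled_lattice_hash d l x = lattice_hash d (level_width d) (\<lambda>i. x i * lattice_scale d l)"

lemma is_hash_scaled_lattice_hash:
  assumes "0 < d" "0 < l"
  shows "is_hash d (real (ceil_sqrt d) * (2 * real d + 3)) (d + 1) l (scaled_lattice_hash d l)"
proof -
  let ?c = "real (ceil_sqrt d)"
  have "0 < ?c" using ceil_sqrt_pos[OF \<open>0 < d\<close>] by simp
  have "is_hash d (?c / level_width d) (d + 1) ?c (lattice_hash d (level_width d))"
    by (rule is_hash_lattice_hash[OF _ _ \<open>0 < ?c\<close> sqrt_le_ceil_sqrt])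
      (simp_all add: level_width_def field_simps)
  from is_hash_scale[OF this, of "?c / l"] show ?thesis
    using \<open>0 < ?c\<close> \<open>0 < l\<close>
    by (simp add: scaled_lattice_hash_def[abs_def] lattice_scale_def level_width_def)
qed

section \<open>Programs\<close>

type_synonym assn = "regs \<Rightarrow> memory \<Rightarrow> bool"

text \<open>Jump targets are absolute, so a piece of code depends on the address at which it starts.\<close>

type_synonym code = "nat \<Rightarrow> instr list"

definition runs :: "instr list \<Rightarrow> nat \<Rightarrow> nat \<Rightarrow> config \<Rightarrow> (config \<Rightarrow> bool) \<Rightarrow> bool" where
  "runs P s n c Q \<longleftrightarrow> Q ((step P ^^ n) c) \<and> (\<forall>k<n. within_space P s ((step P ^^ k) c))"

lemma runs_0: "runs P s 0 c Q \<longleftrightarrow> Q c"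
  by (simp add: runs_def)

lemma runs_Suc: "runs P s (Suc n) c Q \<longleftrightarrow> within_space P s c \<and> runs P s n (step P c) Q"
  unfolding runs_def All_less_Suc2 by (auto simp: funpow_swap1)

lemma runs_add: "runs P s (n + n') c Q \<longleftrightarrow> runs P s n c (\<lambda>c'. runs P s n' c' Q)"
  by (induction n arbitrary: c) (simp_all add: runs_0 runs_Suc)

lemma runs_mono:
  assumes "runs P s n c Q" "\<And>c'. Q c' \<Longrightarrow> R c'"
  shows "runs P s n c R"
  using assms by (simp add: runs_def)

lemma runs_trans:
  assumes "runs P s n c Q" "\<And>c'. Q c' \<Longrightarrow> runs P s n' c' R"
  shows "runs P s (n + n') c R"
  unfolding runs_add using assms by (rule runs_mono)

lemma runs_iterate:
  assumes "\<And>k c. k < n \<Longrightarrow> I k c \<Longrightarrow> runs P s t c (I (Suc k))" "I 0 c"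
  shows "runs P s (n * t) c (I n)"
  using assms(1)
proof (induction n)
  case 0
  with assms(2) show ?case by (simp add: runs_0)
next
  case (Suc n)
  then have "runs P s (n * t + t) c (I (Suc n))"
    by (intro runs_trans[of P s "n * t" c "I n"]) auto
  then show ?case by (simp add: add.commute)
qed

definition hoare :: "nat \<Rightarrow> assn \<Rightarrow> code \<Rightarrow> nat \<Rightarrow> assn \<Rightarrow> bool" where
  "hoare s Pre C t Post \<longleftrightarrow>
     (\<forall>A B r m. Pre r m \<longrightarrow>
        runs (A @ C (length A) @ B) s t (length A, r, m)
          (\<lambda>(pc, r', m'). pc = length (A @ C (length A)) \<and> Post r' m'))"

lemma hoareD:
  assumes "hoare s Pre C t Post" "Pre r m"
  shows "runs (A @ C (length A) @ B) s t (length A, r, m)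
    (\<lambda>(pc, r', m'). pc = length (A @ C (length A)) \<and> Post r' m')"
  using assms unfolding hoare_def by blast

lemma hoare_conseq:
  assumes "hoare s Pre' C t' Post'" "\<And>r m. Pre r m \<Longrightarrow> Pre' r m" "\<And>r m. Post' r m \<Longrightarrow> Post r m" "t' = t"
  shows "hoare s Pre C t Post"
  unfolding hoare_def
proof (intro allI impI)
  fix A B :: "instr list" and r m
  assume "Pre r m"
  from hoareD[OF assms(1) assms(2)[OF this], of A B]
  show "runs (A @ C (length A) @ B) s t (length A, r, m)
      (\<lambda>(pc, r', m'). pc = length (A @ C (length A)) \<and> Post r' m')"
    unfolding assms(4) by (rule runs_mono) (auto intro: assms(3))
qed

definition seq :: "code \<Rightarrow> code \<Rightarrow> code"  (infixr ";;" 60) where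
  "(C ;; D) a = C a @ D (a + length (C a))"

lemma hoare_seq:
  assumes "hoare s Pre C t Mid" "hoare s Mid D u Post"
  shows "hoare s Pre (C ;; D) (t + u) Post"
  unfolding hoare_def
proof (intro allI impI)
  fix A B :: "instr list" and r m
  assume "Pre r m"
  let ?C = "C (length A)" and ?D = "D (length A + length (C (length A)))"
  have "runs (A @ ?C @ ?D @ B) s (t + u) (length A, r, m)
      (\<lambda>(pc, r', m'). pc = length (A @ ?C @ ?D) \<and> Post r' m')"
  proof (rule runs_trans[OF hoareD[OF assms(1) \<open>Pre r m\<close>]], clarify)
    fix r' m'
    assume "Mid r' m'"
    from hoareD[OF assms(2) this, of "A @ ?C" B]
    show "runs (A @ ?C @ ?D @ B) s u (length (A @ ?C), r', m')
        (\<lambda>(pc, r', m'). pc = length (A @ ?C @ ?D) \<and> Post r' m')"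
      by simp
  qed
  then show "runs (A @ (C ;; D) (length A) @ B) s (t + u) (length A, r, m)
      (\<lambda>(pc, r', m'). pc = length (A @ (C ;; D) (length A)) \<and> Post r' m')"
    by (simp add: seq_def)
qed

lemma step_at: "step (A @ i # B) (length A, r, m) = exec_instr i (length A, r, m)"
  by (simp add: step_def halted_def)

lemma within_space_at:
  "within_space (A @ i # B) s (length A, r, m) \<longleftrightarrow> regs_used i \<union> mem_used i r \<subseteq> {..<s}"
  by (simp add: within_space_def halted_def)

fun is_jump :: "instr \<Rightarrow> bool" where
  "is_jump (JumpLe l i j) = True"
| "is_jump i = False"

fun wp :: "nat \<Rightarrow> instr list \<Rightarrow> assn \<Rightarrow> assn" where
  "wp s [] Q r m = Q r m"
| "wp s (i # is) Q r m =
     (\<not> is_jump i \<and> regs_used i \<union> mem_used i r \<subseteq> {..<s} \<and>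
      (case exec_instr i (0, r, m) of (_, r', m') \<Rightarrow> wp s is Q r' m'))"

lemma exec_instr_no_jump:
  "\<not> is_jump i \<Longrightarrow> exec_instr i (pc, r, m) = (Suc pc, snd (exec_instr i (0, r, m)))"
  by (cases i) auto

lemma runs_block:
  assumes "wp s is Q r m"
  shows "runs (A @ is @ B) s (length is) (length A, r, m)
    (\<lambda>(pc, r', m'). pc = length (A @ is) \<and> Q r' m')"
  using assms
proof (induction "is" arbitrary: A r m)
  case Nil
  then show ?case by (simp add: runs_0)
next
  case (Cons i "is")
  obtain r' m' where exec: "snd (exec_instr i (0, r, m)) = (r', m')" by fastforce
  with Cons.prems have "wp s is Q r' m'" by (simp add: case_prod_beta)
  from Cons.IH[OF this, of "A @ [i]"]
  have "runs (A @ i # is @ B) s (length is) (Suc (length A), r', m')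
      (\<lambda>(pc, r', m'). pc = length (A @ i # is) \<and> Q r' m')"
    by simp
  with Cons.prems exec show ?case
    by (simp add: runs_Suc step_at within_space_at exec_instr_no_jump[where pc = "length A"])
qed

definition block :: "instr list \<Rightarrow> code" where
  "block is a = is"

lemma hoare_block:
  assumes "\<And>r m. Pre r m \<Longrightarrow> wp s is Post r m" "length is = t"
  shows "hoare s Pre (block is) t Post"
  using runs_block assms by (auto simp: hoare_def block_def)

definition while_gt :: "code \<Rightarrow> nat \<Rightarrow> nat \<Rightarrow> code \<Rightarrow> code" where
  "while_gt T i j C a =
     (let b = a + length (T a) + 1
      in T a @ JumpLe (b + length (C b) + 1) i j # C b @ [JumpLe a 0 0])"

lemma runs_JumpLe:
  assumes "i < s" "j < s"
  shows "runs (A @ JumpLe a i j # B) s 1 (length A, r, m) Q \<longleftrightarrow>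
    Q (if r i \<le> r j then a else Suc (length A), r, m)"
  using assms by (simp add: runs_Suc runs_0 step_at within_space_at)

lemma runs_while_gt_iteration:
  assumes test: "hoare s Inv T t Test" and body: "hoare s Test C u Inv'"
    and go: "\<And>r m. Test r m \<Longrightarrow> r j < r i"
    and space: "i < s" "j < s" and "Inv r m"
  shows "runs (A @ while_gt T i j C (length A) @ B) s (t + u + 2) (length A, r, m)
    (\<lambda>(pc, r', m'). pc = length A \<and> Inv' r' m')"
proof -
  let ?a = "length A"
  let ?b = "?a + length (T ?a) + 1"
  let ?J = "JumpLe (?b + length (C ?b) + 1) i j" and ?K = "JumpLe ?a 0 0"
  let ?P = "A @ T ?a @ ?J # C ?b @ ?K # B" and ?Q = "\<lambda>(pc, r', m'). pc = ?a \<and> Inv' r' m'"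
  have jump_back: "runs ?P s 1 (length (A @ T ?a @ ?J # C ?b), r, m) ?Q" if "Inv' r m" for r m
    using that runs_JumpLe[of 0 s 0 "A @ T ?a @ ?J # C ?b" ?a B r m ?Q] space by simp
  have run_body: "runs ?P s (u + 1) (?b, r, m) ?Q" if "Test r m" for r m
  proof -
    from hoareD[OF body that, of "A @ T ?a @ [?J]" "?K # B"]
    have "runs ?P s u (?b, r, m)
        (\<lambda>(pc, r', m'). pc = length (A @ T ?a @ ?J # C ?b) \<and> Inv' r' m')"
      by simp
    then show ?thesis by (rule runs_trans, clarify) (rule jump_back)
  qed
  have run_round: "runs ?P s (1 + (u + 1)) (length (A @ T ?a), r, m) ?Q" if "Test r m" for r m
    unfolding runs_add[of _ _ 1]
    using runs_JumpLe[OF space, of "A @ T ?a" _ "C ?b @ ?K # B"] run_body[OF that] go[OF that]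
    by simp
  have "runs ?P s (t + (1 + (u + 1))) (?a, r, m) ?Q"
    by (rule runs_trans[OF hoareD[OF test \<open>Inv r m\<close>]], clarify) (rule run_round)
  then show ?thesis by (simp add: while_gt_def Let_def)
qed

lemma runs_while_gt_exit:
  assumes test: "hoare s Inv T t Test" and stop: "\<And>r m. Test r m \<Longrightarrow> r i \<le> r j"
    and space: "i < s" "j < s" and "Inv r m"
  shows "runs (A @ while_gt T i j C (length A) @ B) s (t + 1) (length A, r, m)
    (\<lambda>(pc, r', m'). pc = length (A @ while_gt T i j C (length A)) \<and> Test r' m')"
proof -
  let ?a = "length A"
  let ?b = "?a + length (T ?a) + 1"
  let ?e = "?b + length (C ?b) + 1"
  let ?R = "C ?b @ JumpLe ?a 0 0 # B"
  have "runs (A @ T ?a @ JumpLe ?e i j # ?R) s (t + 1) (?a, r, m)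
      (\<lambda>(pc, r', m'). pc = ?e \<and> Test r' m')"
  proof (rule runs_trans[OF hoareD[OF test \<open>Inv r m\<close>]], clarify)
    fix r m
    assume "Test r m"
    with runs_JumpLe[OF space, of "A @ T ?a" ?e ?R r m] stop
    show "runs (A @ T ?a @ JumpLe ?e i j # ?R) s 1 (length (A @ T ?a), r, m)
        (\<lambda>(pc, r', m'). pc = ?e \<and> Test r' m')"
      by simp
  qed
  then show ?thesis by (simp add: while_gt_def Let_def add.assoc)
qed

lemma hoare_while_gt:
  assumes test: "\<And>k. k \<le> n \<Longrightarrow> hoare s (I k) T t (J k)"
    and body: "\<And>k. k < n \<Longrightarrow> hoare s (J k) C u (I (Suc k))"
    and go: "\<And>k r m. k < n \<Longrightarrow> J k r m \<Longrightarrow> r j < r i"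
    and stop: "\<And>r m. J n r m \<Longrightarrow> r i \<le> r j"
    and space: "i < s" "j < s"
  shows "hoare s (I 0) (while_gt T i j C) (n * (t + u + 2) + (t + 1)) (J n)"
  unfolding hoare_def
proof (intro allI impI)
  fix A B :: "instr list" and r m
  assume "I 0 r m"
  let ?P = "A @ while_gt T i j C (length A) @ B"
  have iterations: "runs ?P s (n * (t + u + 2)) (length A, r, m)
      (\<lambda>(pc, r', m'). pc = length A \<and> I n r' m')"
  proof (rule runs_iterate)
    show "runs ?P s (t + u + 2) c (\<lambda>(pc, r', m'). pc = length A \<and> I (Suc k) r' m')"
      if "k < n" "case c of (pc, r, m) \<Rightarrow> pc = length A \<and> I k r m" for k c
      using that runs_while_gt_iteration[OF test body go space] by (cases c) auto
  qed (use \<open>I 0 r m\<close> in simp)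
  show "runs ?P s (n * (t + u + 2) + (t + 1)) (length A, r, m)
      (\<lambda>(pc, r', m'). pc = length (A @ while_gt T i j C (length A)) \<and> J n r' m')"
  proof (rule runs_trans[OF iterations], clarify)
    fix r' m'
    assume "I n r' m'"
    show "runs ?P s (t + 1) (length A, r', m')
        (\<lambda>(pc, r', m'). pc = length (A @ while_gt T i j C (length A)) \<and> J n r' m')"
      by (rule runs_while_gt_exit[OF test[OF order_refl] stop space \<open>I n r' m'\<close>])
  qed
qed

lemma evaluates_withinI:
  assumes "\<And>x. x \<in> topspace (Euclidean_space d) \<Longrightarrow>
      hoare s (\<lambda>r m. r = (\<lambda>_. 0)(0 := real d, 1 := l) \<and> m = x) C (n x) (\<lambda>_ m. \<forall>i<d. m i = \<phi> x i)"
    and "\<And>x. n x \<le> t"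
  shows "evaluates_within (C 0) d l \<phi> t s"
  unfolding evaluates_within_def
proof
  fix x
  assume "x \<in> topspace (Euclidean_space d)"
  from hoareD[OF assms(1)[OF this], where A = "[]" and B = "[]"]
  have "runs (C 0) s (n x) (init_config d l x)
      (\<lambda>(pc, _, m). pc = length (C 0) \<and> (\<forall>i<d. m i = \<phi> x i))"
    by (simp add: init_config_def)
  then show "\<exists>n\<le>t. halted (C 0) ((step (C 0) ^^ n) (init_config d l x)) \<and>
      (\<forall>i<d. snd (snd ((step (C 0) ^^ n) (init_config d l x))) i = \<phi> x i) \<and>
      (\<forall>k<n. within_space (C 0) s ((step (C 0) ^^ k) (init_config d l x)))"
    by (intro exI[of _ "n x"]) (simp add: assms(2) runs_def halted_def case_prod_beta)
qed

section \<open>Evaluating the hash\<close>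

text \<open>
  The pair \<open>\<lfloor>u + t\<rfloor>\<close>, \<open>\<lfloor>t - u\<rfloor>\<close> tells both whether \<open>u\<close> is near an integer and which cell it lies
  in, so the program neither rounds nor branches on a coordinate.
\<close>

lemma floor_shifts_near:
  assumes "int_dist u \<le> t" "t < 1/2"
  shows "\<lfloor>u + t\<rfloor> = round u" "\<lfloor>t - u\<rfloor> = - round u"
  using assms unfolding int_dist_def by linarith+

lemma floor_shifts_far:
  assumes "0 \<le> t" "t < int_dist u"
  shows "\<lfloor>u + t\<rfloor> = \<lfloor>u\<rfloor>" "\<lfloor>t - u\<rfloor> = - \<lfloor>u\<rfloor> - 1"
  using assms int_dist_le[of u "\<lfloor>u\<rfloor>"] int_dist_le[of u "\<lfloor>u\<rfloor> + 1"] by linarith+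

lemma cell_eq_floors:
  assumes "0 \<le> t" "t < 1/2"
  shows "cell t u = \<lfloor>u + t\<rfloor> - \<lfloor>t - u\<rfloor>"
  using floor_shifts_near[of u t] floor_shifts_far[of t u] assms by (auto simp: cell_def)

lemma of_bool_near_eq_floors:
  assumes "0 \<le> t" "t < 1/2"
  shows "of_bool (int_dist u \<le> t) = \<lfloor>u + t\<rfloor> + \<lfloor>t - u\<rfloor> + 1"
  using floor_shifts_near[of u t] floor_shifts_far[of t u] assms by auto

abbreviation (input) reg_dim :: nat where "reg_dim \<equiv> 0"
abbreviation (input) reg_bound :: nat where "reg_bound \<equiv> 1"
abbreviation (input) reg_one :: nat where "reg_one \<equiv> 2"
abbreviation (input) reg_root :: nat where "reg_root \<equiv> 3"
abbreviation (input) reg_scale :: nat where "reg_scale \<equiv> 4"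
abbreviation (input) reg_width :: nat where "reg_width \<equiv> 5"
abbreviation (input) reg_level :: nat where "reg_level \<equiv> 6"
abbreviation (input) reg_count :: nat where "reg_count \<equiv> 7"
abbreviation (input) reg_index :: nat where "reg_index \<equiv> 8"
abbreviation (input) reg_radius :: nat where "reg_radius \<equiv> 9"
abbreviation (input) reg_hi :: nat where "reg_hi \<equiv> 10"
abbreviation (input) reg_lo :: nat where "reg_lo \<equiv> 11"

definition root_code :: code where
  "root_code =
     block [Const reg_one 1, Const reg_root 0] ;;
     while_gt (block [Mul reg_hi reg_root reg_root]) reg_dim reg_hi
       (block [Add reg_root reg_root reg_one])"

definition scale_code :: code where
  "scale_code = block
     [Div reg_scale reg_root reg_bound,
      Add reg_hi reg_dim reg_dim,
      Const reg_lo 3,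
      Add reg_hi reg_hi reg_lo,
      Div reg_width reg_one reg_hi,
      Const reg_level 0]"

definition floor_shifts :: "instr list" where
  "floor_shifts =
     [Load reg_hi reg_index,
      Mul reg_hi reg_hi reg_scale,
      Sub reg_lo reg_radius reg_hi,
      Floor reg_lo reg_lo,
      Add reg_hi reg_hi reg_radius,
      Floor reg_hi reg_hi]"

definition count_step :: "instr list" where
  "count_step = floor_shifts @
     [Add reg_count reg_count reg_hi,
      Add reg_count reg_count reg_lo,
      Add reg_count reg_count reg_one,
      Add reg_index reg_index reg_one]"

definition count_code :: code where
  "count_code =
     block
       [Add reg_radius reg_level reg_one,
        Mul reg_radius reg_radius reg_width,
        Const reg_count 0,
        Const reg_index 0] ;;
     while_gt (block []) reg_dim reg_index (block count_step)"

definition level_code :: code where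
  "level_code = while_gt count_code reg_count reg_level (block [Add reg_level reg_level reg_one])"

definition output_step :: "instr list" where
  "output_step = floor_shifts @
     [Sub reg_hi reg_hi reg_lo,
      Store reg_index reg_hi,
      Add reg_index reg_index reg_one]"

definition output_code :: code where
  "output_code =
     block [Mul reg_radius reg_level reg_width, Const reg_index 0] ;;
     while_gt (block []) reg_dim reg_index (block output_step)"

definition hash_code :: code where
  "hash_code = root_code ;; scale_code ;; level_code ;; output_code"

lemma addr_of_nat [simp]: "addr (real n) = n"
  by (simp add: addr_def)

definition raw_input :: "nat \<Rightarrow> real \<Rightarrow> (nat \<Rightarrow> real) \<Rightarrow> assn" where
  "raw_input d l x r m \<longleftrightarrow> r reg_dim = real d \<and> r reg_bound = l \<and> m = x"

lemma hoare_root_code: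
  assumes "12 \<le> s"
  shows "hoare s (raw_input d l x) root_code (4 * ceil_sqrt d + 4)
    (\<lambda>r m. raw_input d l x r m \<and> r reg_one = 1 \<and> r reg_root = real (ceil_sqrt d))"
proof -
  let ?I = "\<lambda>k r m. raw_input d l x r m \<and> r reg_one = 1 \<and> r reg_root = real k"
  let ?J = "\<lambda>k r m. ?I k r m \<and> r reg_hi = real (k\<^sup>2)"
  have init: "hoare s (raw_input d l x) (block [Const reg_one 1, Const reg_root 0]) 2 (?I 0)"
    using assms by (intro hoare_block) (auto simp: raw_input_def)
  have test: "hoare s (?I k) (block [Mul reg_hi reg_root reg_root]) 1 (?J k)" for k
    using assms by (intro hoare_block) (auto simp: raw_input_def power2_eq_square)
  have body: "hoare s (?J k) (block [Add reg_root reg_root reg_one]) 1 (?I (Suc k))" for k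
    using assms by (intro hoare_block) (auto simp: raw_input_def)
  have "hoare s (?I 0) (while_gt (block [Mul reg_hi reg_root reg_root]) reg_dim reg_hi
      (block [Add reg_root reg_root reg_one]))
      (ceil_sqrt d * (1 + 1 + 2) + (1 + 1)) (?J (ceil_sqrt d))"
  proof (rule hoare_while_gt[where I = ?I and J = ?J, OF test body])
    show "r reg_hi < r reg_dim" if "k < ceil_sqrt d" "?J k r m" for k r m
      using that ceil_sqrt_le_iff[of d k] by (simp add: raw_input_def flip: of_nat_power)
    show "r reg_dim \<le> r reg_hi" if "?J (ceil_sqrt d) r m" for r m
      using that ceil_sqrt_le_iff[of d "ceil_sqrt d"]
      by (simp add: raw_input_def flip: of_nat_power)
  qed (use assms in auto)
  from hoare_seq[OF init this] show ?thesis
    unfolding root_code_def by (rule hoare_conseq) auto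
qed

lemma multiple_level_width_bounds:
  assumes "m \<le> d + 1"
  shows "0 \<le> real m * level_width d" "real m * level_width d < 1/2"
  using assms by (simp_all add: level_width_def field_simps)

definition scaled_input :: "nat \<Rightarrow> real \<Rightarrow> real \<Rightarrow> (nat \<Rightarrow> real) \<Rightarrow> assn" where
  "scaled_input d q \<epsilon> x r m \<longleftrightarrow>
     r reg_dim = real d \<and> r reg_one = 1 \<and> r reg_scale = q \<and> r reg_width = \<epsilon> \<and> m = x"

lemma hoare_scale_code:
  assumes "12 \<le> s"
  shows "hoare s
    (\<lambda>r m. raw_input d l x r m \<and> r reg_one = 1 \<and> r reg_root = real (ceil_sqrt d))
    scale_code 6 (\<lambda>r m. scaled_input d (lattice_scale d l) (level_width d) x r m \<and> r reg_level = 0)"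
  unfolding scale_code_def
  using assms by (intro hoare_block)
    (auto simp: raw_input_def scaled_input_def lattice_scale_def level_width_def)

lemma hoare_count_code:
  assumes s: "12 \<le> s" "d \<le> s" and radius: "0 \<le> real (Suc k) * \<epsilon>" "real (Suc k) * \<epsilon> < 1/2"
  shows "hoare s (\<lambda>r m. scaled_input d q \<epsilon> x r m \<and> r reg_level = real k) count_code (12 * d + 5)
    (\<lambda>r m. scaled_input d q \<epsilon> x r m \<and> r reg_level = real k \<and>
       r reg_count = real (card (near_coords d (real (Suc k) * \<epsilon>) (\<lambda>i. x i * q))))"
proof -
  let ?t = "real (Suc k) * \<epsilon>"
  let ?I = "\<lambda>j r m. scaled_input d q \<epsilon> x r m \<and> r reg_level = real k \<and> r reg_radius = ?t \<and>
    r reg_index = real j \<and> r reg_count = real (card (near_coords j ?t (\<lambda>i. x i * q)))"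
  have count: "real (card (near_coords (Suc j) ?t (\<lambda>i. x i * q))) =
      real (card (near_coords j ?t (\<lambda>i. x i * q)))
      + of_int \<lfloor>x j * q + ?t\<rfloor> + of_int \<lfloor>?t - x j * q\<rfloor> + 1" for j
    using arg_cong[OF of_bool_near_eq_floors[OF radius, of "x j * q"], of real_of_int]
    by (simp add: card_near_coords_Suc)
  have init: "hoare s (\<lambda>r m. scaled_input d q \<epsilon> x r m \<and> r reg_level = real k)
      (block [Add reg_radius reg_level reg_one, Mul reg_radius reg_radius reg_width,
        Const reg_count 0, Const reg_index 0]) 4 (?I 0)"
    using s by (intro hoare_block) (auto simp: scaled_input_def near_coords_0 add.commute)
  have body: "hoare s (?I j) (block count_step) 10 (?I (Suc j))" if "j < d" for j
    using s that count[of j]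
    by (intro hoare_block) (simp_all add: count_step_def floor_shifts_def scaled_input_def)
  have "hoare s (?I 0) (while_gt (block []) reg_dim reg_index (block count_step))
      (d * (0 + 10 + 2) + (0 + 1)) (?I d)"
    by (rule hoare_while_gt[where I = ?I and J = ?I, OF hoare_block body])
      (use s in \<open>auto simp: scaled_input_def\<close>)
  from hoare_seq[OF init this] show ?thesis
    unfolding count_code_def by (rule hoare_conseq) auto
qed

lemma hoare_level_code:
  fixes d q x
  defines "L \<equiv> level d (level_width d) (\<lambda>i. x i * q)"
  assumes s: "12 \<le> s" "d \<le> s"
  shows "hoare s (\<lambda>r m. scaled_input d q (level_width d) x r m \<and> r reg_level = 0)
    level_code ((12 * d + 8) * L + (12 * d + 6))
    (\<lambda>r m. scaled_input d q (level_width d) x r m \<and> r reg_level = real L)"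
proof -
  let ?n = "\<lambda>k. card (near_coords d (real (Suc k) * level_width d) (\<lambda>i. x i * q))"
  let ?I = "\<lambda>k r m. scaled_input d q (level_width d) x r m \<and> r reg_level = real k"
  let ?J = "\<lambda>k r m. scaled_input d q (level_width d) x r m \<and> r reg_level = real k \<and>
    r reg_count = real (?n k)"
  have test: "hoare s (?I k) count_code (12 * d + 5) (?J k)" if "k \<le> L" for k
    using that level_le[of d "level_width d" "\<lambda>i. x i * q"] unfolding L_def
    by (intro hoare_count_code s multiple_level_width_bounds) simp_all
  have body: "hoare s (?J k) (block [Add reg_level reg_level reg_one]) 1 (?I (Suc k))" for k
    using s by (intro hoare_block) (auto simp: scaled_input_def)
  have "hoare s (?I 0) level_code (L * (12 * d + 5 + 1 + 2) + (12 * d + 5 + 1)) (?J L)"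
    unfolding level_code_def
  proof (rule hoare_while_gt[where I = ?I and J = ?J, OF test body])
    show "r reg_level < r reg_count" if "k < L" "?J k r m" for k r m
      using that less_card_near_coords_if_less_level[of k d "level_width d" "\<lambda>i. x i * q"]
      by (simp add: L_def)
    show "r reg_count \<le> r reg_level" if "?J L r m" for r m
      using that card_near_coords_level_le[of d "level_width d" "\<lambda>i. x i * q"] by (simp add: L_def)
  qed (use s in auto)
  then show ?thesis by (rule hoare_conseq) (auto simp: algebra_simps)
qed

lemma hoare_output_code:
  assumes s: "12 \<le> s" "d \<le> s" and radius: "0 \<le> real k * \<epsilon>" "real k * \<epsilon> < 1/2"
  shows "hoare s (\<lambda>r m. scaled_input d q \<epsilon> x r m \<and> r reg_level = real k) output_code (11 * d + 3)
    (\<lambda>_ m. \<forall>i<d. m i = of_int (cell (real k * \<epsilon>) (x i * q)))"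
proof -
  let ?t = "real k * \<epsilon>"
  let ?I = "\<lambda>j r m. r reg_dim = real d \<and> r reg_one = 1 \<and> r reg_scale = q \<and> r reg_radius = ?t \<and>
    r reg_index = real j \<and> m = (\<lambda>i. if i < j then of_int (cell ?t (x i * q)) else x i)"
  have init: "hoare s (\<lambda>r m. scaled_input d q \<epsilon> x r m \<and> r reg_level = real k)
      (block [Mul reg_radius reg_level reg_width, Const reg_index 0]) 2 (?I 0)"
    using s by (intro hoare_block) (auto simp: scaled_input_def)
  have body: "hoare s (?I j) (block output_step) 9 (?I (Suc j))" if "j < d" for j
    using s that cell_eq_floors[OF radius, of "x j * q"]
    by (intro hoare_block) (auto simp: output_step_def floor_shifts_def less_Suc_eq fun_eq_iff)
  have "hoare s (?I 0) (while_gt (block []) reg_dim reg_index (block output_step))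
      (d * (0 + 9 + 2) + (0 + 1)) (?I d)"
    by (rule hoare_while_gt[where I = ?I and J = ?I, OF hoare_block body]) (use s in auto)
  from hoare_seq[OF init this] show ?thesis
    unfolding output_code_def by (rule hoare_conseq) auto
qed

lemma hoare_hash_code:
  fixes d l x
  defines "L \<equiv> level d (level_width d) (\<lambda>i. x i * lattice_scale d l)"
  assumes s: "12 \<le> s" "d \<le> s"
  shows "hoare s (raw_input d l x) hash_code ((12 * d + 8) * L + 4 * ceil_sqrt d + 23 * d + 19)
    (\<lambda>_ m. \<forall>i<d. m i = scaled_lattice_hash d l x i)"
proof -
  have radius: "0 \<le> real L * level_width d" "real L * level_width d < 1/2"
    using level_le[of d "level_width d"] unfolding L_def
    by (intro multiple_level_width_bounds trans_le_add1, blast)+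
  note level = hoare_level_code[OF s, where x = x and q = "lattice_scale d l", folded L_def]
  from hoare_seq[OF hoare_root_code[OF s(1)]
      hoare_seq[OF hoare_scale_code[OF s(1)]
        hoare_seq[OF level hoare_output_code[OF s radius]]]]
  show ?thesis
    unfolding hash_code_def
    by (rule hoare_conseq) (auto simp: scaled_lattice_hash_def lattice_hash_def L_def)
qed

lemma evaluates_within_hash_code:
  "evaluates_within (hash_code 0) d l (scaled_lattice_hash d l)
     (poly [:19, 35, 12:] d) (poly [:12, 1:] d)"
proof (rule evaluates_withinI)
  let ?level = "\<lambda>x. level d (level_width d) (\<lambda>i. x i * lattice_scale d l)"
  show "hoare (poly [:12, 1:] d) (\<lambda>r m. r = (\<lambda>_. 0)(0 := real d, 1 := l) \<and> m = x) hash_code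
      ((12 * d + 8) * ?level x + 4 * ceil_sqrt d + 23 * d + 19)
      (\<lambda>_ m. \<forall>i<d. m i = scaled_lattice_hash d l x i)" for x
    by (rule hoare_conseq[OF hoare_hash_code]) (auto simp: raw_input_def)
  fix x
  have "ceil_sqrt d \<le> d" by (simp add: ceil_sqrt_le_iff power2_eq_square)
  moreover have "(12 * d + 8) * ?level x \<le> (12 * d + 8) * d"
    by (intro mult_left_mono level_le) simp
  ultimately show "(12 * d + 8) * ?level x + 4 * ceil_sqrt d + 23 * d + 19 \<le> poly [:19, 35, 12:] d"
    by (simp add: algebra_simps)
qed

theorem theorem5p2:
  shows "\<exists>(\<Gamma> :: nat \<Rightarrow> real)
           (\<phi> :: nat \<Rightarrow> real \<Rightarrow> (nat \<Rightarrow> real) \<Rightarrow> (nat \<Rightarrow> real))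
           (P :: instr list) (time :: nat poly) (space :: nat poly).
           \<Gamma> \<in> \<Theta>(\<lambda>d. real d * sqrt (real d)) \<and>
           (\<forall>d\<ge>1. \<forall>l>0.
              is_hash d (\<Gamma> d) (d + 1) l (\<phi> d l) \<and>
              evaluates_within P d l (\<phi> d l) (poly time d) (poly space d))"
proof (intro exI conjI allI impI)
  show "(\<lambda>d. real (ceil_sqrt d) * (2 * real d + 3)) \<in> \<Theta>(\<lambda>d. real d * sqrt (real d))"
    by (rule bigtheta_ceil_sqrt)
next
  fix d :: nat and l :: real
  assume "1 \<le> d" "0 < l"
  then show "is_hash d (real (ceil_sqrt d) * (2 * real d + 3)) (d + 1) l (scaled_lattice_hash d l)"
    by (intro is_hash_scaled_lattice_hash) auto
  show "evaluates_within (hash_code 0) d l (scaled_lattice_hash d l)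
      (poly [:19, 35, 12:] d) (poly [:12, 1:] d)"
    by (rule evaluates_within_hash_code)
qed

end
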